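(* Let $\mathcal{H}=\mathcal{H}_1\otimes\mathcal{H}_2\otimes\mathcal{H}_3$ with $\dim\mathcal{H}_i=d_i$. For every unitary $U\in U(d_1d_2d_3)$ acting on $\mathcal{H}$ and every $ab|c\in\{12|3,13|2,23|1\}$ one has $\epsilon_{ab|c}(U)\le\tilde\epsilon_{ab|c}$, and consequently $\epsilon_1(U)\le\tilde\epsilon_1:=\frac13(\tilde\epsilon_{12|3}+\tilde\epsilon_{13|2}+\tilde\epsilon_{23|1})$, where $$\tilde\epsilon_{ab|c}:=2-2\Bigg(\prod_{i=1}^3\frac{d_i}{d_i+1}\Bigg)\left[8-\sum_{x'|y'}\frac{\min(d_{abx'},d_{cy'})-1}{\min(d_{abx'},d_{cy'})}\right],$$ the sum running over all eight ordered bipartitions $x'|y'$ of $\{1',2',3'\}$ (including $x'=\emptyset$ and $y'=\emptyset$), with $d_{abx'}=d_ad_b\prod_{i'\in x'}d_i$ and $d_{cy'}=d_c\prod_{i'\in y'}d_i$.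
   Context: For a pure state $|\psi\rangle\in\mathcal{H}$ and a bipartition $g|g'$ of $\{1,2,3\}$, $\tau_{g|g'}(|\psi\rangle)=2\big(1-\operatorname{tr}[(\operatorname{tr}_g|\psi\rangle\langle\psi|)^2]\big)$; the one-tangle is $\tau_1=\frac13(\tau_{12|3}+\tau_{13|2}+\tau_{23|1})$. For a unitary $U$ on $\mathcal{H}$, $\epsilon_{ab|c}(U)$ (resp. $\epsilon_1(U)$) is the average of $\tau_{ab|c}(U|\psi_{\rm sep}\rangle)$ (resp. $\tau_1(U|\psi_{\rm sep}\rangle)$) over $|\psi_{\rm sep}\rangle=|\psi_1\rangle\otimes|\psi_2\rangle\otimes|\psi_3\rangle$, each $|\psi_i\rangle$ drawn independently from the unitarily invariant measure on pure states of $\mathcal{H}_i$. The primed labels $1',2',3'$ refer to a copy $\mathcal{H}'=\mathcal{H}_{1'}\otimes\mathcal{H}_{2'}\otimes\mathcal{H}_{3'}$ of $\mathcal{H}$ with $\dim\mathcal{H}_{i'}=d_i$. *)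

theory Defs
  imports "HOL-Probability.Probability"
begin

definition cadjoint :: "complex^'n^'m \<Rightarrow> complex^'m^'n" where
  "cadjoint V = (\<chi> i j. cnj (V $ j $ i))"

definition unitary_cmat :: "complex^'n^'n \<Rightarrow> bool" where
  "unitary_cmat V \<longleftrightarrow> V ** cadjoint V = mat 1 \<and> cadjoint V ** V = mat 1"

definition unitarily_invariant_pure_state_measure :: "(complex^'n) measure \<Rightarrow> bool" where
  "unitarily_invariant_pure_state_measure \<mu> \<longleftrightarrow>
     prob_space \<mu> \<and> sets \<mu> = sets borel \<and> (AE \<psi> in \<mu>. norm \<psi> = 1) \<and>
     (\<forall>V. unitary_cmat V \<longrightarrow> distr \<mu> borel (\<lambda>\<psi>. V *v \<psi>) = \<mu>)"

definition tensor3 :: "complex^'a \<Rightarrow> complex^'b \<Rightarrow> complex^'c \<Rightarrow> complex^('a \<times> 'b \<times> 'c)" where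
  "tensor3 \<psi>1 \<psi>2 \<psi>3 = vec_lambda (\<lambda>(i,j,k). \<psi>1 $ i * \<psi>2 $ j * \<psi>3 $ k)"

definition rho_3 :: "complex^('a::finite \<times> 'b::finite \<times> 'c::finite) \<Rightarrow> 'c \<Rightarrow> 'c \<Rightarrow> complex" where
  "rho_3 \<psi> k k' = (\<Sum>i\<in>UNIV. \<Sum>j\<in>UNIV. \<psi> $ (i,j,k) * cnj (\<psi> $ (i,j,k')))"

definition rho_2 :: "complex^('a::finite \<times> 'b::finite \<times> 'c::finite) \<Rightarrow> 'b \<Rightarrow> 'b \<Rightarrow> complex" where
  "rho_2 \<psi> j j' = (\<Sum>i\<in>UNIV. \<Sum>k\<in>UNIV. \<psi> $ (i,j,k) * cnj (\<psi> $ (i,j',k)))"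

definition rho_1 :: "complex^('a::finite \<times> 'b::finite \<times> 'c::finite) \<Rightarrow> 'a \<Rightarrow> 'a \<Rightarrow> complex" where
  "rho_1 \<psi> i i' = (\<Sum>j\<in>UNIV. \<Sum>k\<in>UNIV. \<psi> $ (i,j,k) * cnj (\<psi> $ (i',j,k)))"

definition trace_sq :: "('i::finite \<Rightarrow> 'i \<Rightarrow> complex) \<Rightarrow> complex" where
  "trace_sq \<rho> = (\<Sum>x\<in>UNIV. \<Sum>y\<in>UNIV. \<rho> x y * \<rho> y x)"

definition tau_12_3 :: "complex^('a::finite \<times> 'b::finite \<times> 'c::finite) \<Rightarrow> real" where
  "tau_12_3 \<psi> = 2 * (1 - Re (trace_sq (rho_3 \<psi>)))"

definition tau_13_2 :: "complex^('a::finite \<times> 'b::finite \<times> 'c::finite) \<Rightarrow> real" where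
  "tau_13_2 \<psi> = 2 * (1 - Re (trace_sq (rho_2 \<psi>)))"

definition tau_23_1 :: "complex^('a::finite \<times> 'b::finite \<times> 'c::finite) \<Rightarrow> real" where
  "tau_23_1 \<psi> = 2 * (1 - Re (trace_sq (rho_1 \<psi>)))"

definition tau1 :: "complex^('a::finite \<times> 'b::finite \<times> 'c::finite) \<Rightarrow> real" where
  "tau1 \<psi> = (tau_12_3 \<psi> + tau_13_2 \<psi> + tau_23_1 \<psi>) / 3"

definition avg_prod ::
  "(complex^('a::finite \<times> 'b::finite \<times> 'c::finite) \<Rightarrow> real) \<Rightarrow> complex^('a\<times>'b\<times>'c)^('a\<times>'b\<times>'c)
   \<Rightarrow> (complex^'a) measure \<Rightarrow> (complex^'b) measure \<Rightarrow> (complex^'c) measure \<Rightarrow> real" where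
  "avg_prod f U \<mu>1 \<mu>2 \<mu>3 =
     (\<integral>p. f (U *v tensor3 (fst p) (fst (snd p)) (snd (snd p))) \<partial>(\<mu>1 \<Otimes>\<^sub>M (\<mu>2 \<Otimes>\<^sub>M \<mu>3)))"

text \<open>eps_tilde for ab|c with dab = d_a d_b, dc = d_c, and d the dimension function on {1,2,3};
  the sum runs over x' \<subseteq> {1',2',3'}, y' its complement.\<close>
definition eps_tilde :: "nat \<Rightarrow> nat \<Rightarrow> (nat \<Rightarrow> nat) \<Rightarrow> real" where
  "eps_tilde dab dc d =
     2 - 2 * (\<Prod>i\<in>{1,2,3}. real (d i) / (real (d i) + 1)) *
       (8 - (\<Sum>x\<in>Pow {1,2,3::nat}.
               (let m = min (dab * (\<Prod>i\<in>x. d i)) (dc * (\<Prod>i\<in>{1,2,3} - x. d i))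
                in (real m - 1) / real m)))"

end

theory Submission
  imports Defs
begin

text \<open>
  Invariance under phases and two-level reflections determines the fourth moments of a random pure
  state in dimension \<open>n\<close>: the mean of \<open>\<psi> i * \<psi> j * cnj (\<psi> k) * cnj (\<psi> l)\<close> is
  \<open>1 / (n * (n + 1))\<close> times \<open>[k = i, l = j] + [k = j, l = i]\<close>. For a product state the three binomials
  multiply out to a sum over the subsets \<open>x'\<close> of the tensor factors, and the mean purity of the image
  of a product state under \<open>U\<close> becomes a sum of the purities of \<open>U\<close>, read as a vector on two copies of
  the space, across the cuts \<open>ab x' | c y'\<close>. By the Cauchy-Schwarz inequality the purity of a state
  is at least the reciprocal of the smaller dimension of the cut.
\<close>

subsection \<open>Purity across a cut\<close>

text \<open>On a product set \<open>A \<times> B\<close> the operation \<open>f (a, b) (a', b') = (a, b')\<close> is a rectangular band, and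
  every rectangular band is of this form. A cut of the index set of a state into two parts is
  therefore encoded by the operation taking the first part from \<open>p\<close> and the second from \<open>q\<close>; the two
  parts have \<open>card (range f)\<close> and \<open>card (range (\<lambda>q p. f p q))\<close> elements.\<close>

definition rectangular_band :: "('p \<Rightarrow> 'p \<Rightarrow> 'p) \<Rightarrow> bool" where
  "rectangular_band f \<longleftrightarrow> (\<forall>p. f p p = p) \<and> (\<forall>p q r s. f (f p q) (f r s) = f p s)"

lemma rectangular_band_idem: "rectangular_band f \<Longrightarrow> f p p = p"
  and rectangular_band_outer: "rectangular_band f \<Longrightarrow> f (f p q) (f r s) = f p s"
  by (auto simp: rectangular_band_def)

lemma rectangular_band_left:
  assumes "rectangular_band f"
  shows "f (f p q) r = f p r"
  using rectangular_band_outer[OF assms, of p q r r] by (simp add: rectangular_band_idem[OF assms])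

lemma rectangular_band_right:
  assumes "rectangular_band f"
  shows "f p (f q r) = f p r"
  using rectangular_band_outer[OF assms, of p p q r] by (simp add: rectangular_band_idem[OF assms])

lemma rectangular_band_flip: "rectangular_band f \<Longrightarrow> rectangular_band (\<lambda>p q. f q p)"
  by (simp add: rectangular_band_def)

lemma bij_betw_rectangular_band:
  assumes "rectangular_band f"
  shows "bij_betw (\<lambda>(a, b). f a b) (range (\<lambda>p. f p e) \<times> range (f e)) UNIV"
  by (rule bij_betw_byWitness[where f' = "\<lambda>p. (f p e, f e p)"])
     (auto simp: rectangular_band_idem[OF assms] rectangular_band_left[OF assms]
        rectangular_band_right[OF assms])

lemma card_range_rectangular_band:
  assumes "rectangular_band f"
  shows "card (range (\<lambda>p. f p e)) = card (range f)"
proof -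
  have "range (\<lambda>p. f p e) = (\<lambda>g. g e) ` range f"
    by auto
  moreover have "inj_on (\<lambda>g. g e) (range f)"
  proof (rule inj_onI, safe)
    fix p q assume "f p e = f q e"
    then show "f p = f q"
      by (metis rectangular_band_left[OF assms] ext)
  qed
  ultimately show ?thesis
    by (simp add: card_image)
qed

definition moment :: "'p \<Rightarrow> 'p \<Rightarrow> 'p \<Rightarrow> 'p \<Rightarrow> ('p \<Rightarrow> complex) \<Rightarrow> complex" where
  "moment i j k l w = w i * w j * cnj (w k) * cnj (w l)"

definition cut_purity :: "('p::finite \<Rightarrow> 'p \<Rightarrow> 'p) \<Rightarrow> ('p \<Rightarrow> complex) \<Rightarrow> complex" where
  "cut_purity f w = (\<Sum>p\<in>UNIV. \<Sum>q\<in>UNIV. moment p q (f p q) (f q p) w)"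

lemma cut_purity_flip: "cut_purity (\<lambda>p q. f q p) w = cut_purity f w"
  by (simp add: cut_purity_def moment_def mult_ac)

definition marginal :: "('a \<times> 'b \<Rightarrow> 'p) \<Rightarrow> 'a set \<Rightarrow> ('p \<Rightarrow> complex) \<Rightarrow> 'b \<Rightarrow> 'b \<Rightarrow> complex" where
  "marginal h A w b b' = (\<Sum>a\<in>A. w (h (a, b)) * cnj (w (h (a, b'))))"

lemma cnj_marginal: "cnj (marginal h A w b b') = marginal h A w b' b"
  by (simp add: marginal_def mult.commute)

lemma marginal_diag: "marginal h A w b b = of_real (\<Sum>a\<in>A. (norm (w (h (a, b))))\<^sup>2)"
  by (simp only: marginal_def of_real_sum complex_norm_square)

lemma cut_purity_eq_marginal:
  fixes h :: "'a \<times> 'b \<Rightarrow> 'p::finite"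
  assumes bij: "bij_betw h (A \<times> B) UNIV"
    and cut: "\<And>a b a' b'. a \<in> A \<Longrightarrow> b \<in> B \<Longrightarrow> a' \<in> A \<Longrightarrow> b' \<in> B \<Longrightarrow> f (h (a, b)) (h (a', b')) = h (a, b')"
  shows "cut_purity f w = (\<Sum>b\<in>B. \<Sum>b'\<in>B. marginal h A w b b' * marginal h A w b' b)"
proof -
  define m where "m a b a' b' = moment (h (a, b)) (h (a', b')) (h (a, b')) (h (a', b)) w" for a b a' b'
  have sum_h: "(\<Sum>p\<in>UNIV. g p) = (\<Sum>a\<in>A. \<Sum>b\<in>B. g (h (a, b)))" for g :: "'p \<Rightarrow> complex"
    by (simp add: sum.reindex_bij_betw[OF bij, symmetric] sum.cartesian_product case_prod_unfold)
  have "cut_purity f w = (\<Sum>a\<in>A. \<Sum>b\<in>B. \<Sum>a'\<in>A. \<Sum>b'\<in>B. m a b a' b')"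
    unfolding cut_purity_def sum_h m_def by (intro sum.cong refl) (simp add: cut)
  also have "\<dots> = (\<Sum>b\<in>B. \<Sum>a\<in>A. \<Sum>b'\<in>B. \<Sum>a'\<in>A. m a b a' b')"
    by (subst sum.swap) (intro sum.cong refl sum.swap)
  also have "\<dots> = (\<Sum>b\<in>B. \<Sum>b'\<in>B. \<Sum>a\<in>A. \<Sum>a'\<in>A. m a b a' b')"
    by (intro sum.cong refl sum.swap)
  also have "\<dots> = (\<Sum>b\<in>B. \<Sum>b'\<in>B. marginal h A w b b' * marginal h A w b' b)"
    by (simp add: marginal_def sum_product m_def moment_def mult_ac)
  finally show ?thesis .
qed

lemma Re_trace_sq_ge:
  assumes "finite B" and hermitian: "\<And>b b'. \<rho> b' b = cnj (\<rho> b b')"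
  shows "(\<Sum>b\<in>B. Re (\<rho> b b))\<^sup>2 / card B \<le> Re (\<Sum>b\<in>B. \<Sum>b'\<in>B. \<rho> b b' * \<rho> b' b)"
proof -
  have "(\<Sum>b\<in>B. Re (\<rho> b b))\<^sup>2 / card B \<le> (\<Sum>b\<in>B. (Re (\<rho> b b))\<^sup>2)"
    using sum_squared_le_sum_of_squares[of "\<lambda>b. Re (\<rho> b b)" B]
    by (cases "card B = 0") (simp_all add: sum_nonneg divide_le_eq)
  also have "\<dots> \<le> (\<Sum>b\<in>B. (norm (\<rho> b b))\<^sup>2)"
    by (intro sum_mono) (simp add: cmod_power2)
  also have "\<dots> \<le> (\<Sum>b\<in>B. \<Sum>b'\<in>B. (norm (\<rho> b b'))\<^sup>2)"
    using assms(1) by (intro sum_mono member_le_sum) auto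
  also have "\<dots> = Re (\<Sum>b\<in>B. \<Sum>b'\<in>B. \<rho> b b' * cnj (\<rho> b b'))"
    by (simp add: complex_norm_square[symmetric] del: of_real_power)
  finally show ?thesis
    unfolding hermitian[symmetric] .
qed

lemma cut_purity_ge_card_right:
  fixes f :: "'p::finite \<Rightarrow> 'p \<Rightarrow> 'p"
  assumes f: "rectangular_band f"
  shows "(\<Sum>p\<in>UNIV. (norm (w p))\<^sup>2)\<^sup>2 / card (range (\<lambda>q p. f p q)) \<le> Re (cut_purity f w)"
proof -
  define e :: 'p where "e = undefined"
  define A B where "A = range (\<lambda>p. f p e)" and "B = range (f e)"
  define h where "h = (\<lambda>(a, b). f a b)"
  have bij: "bij_betw h (A \<times> B) UNIV"
    unfolding h_def A_def B_def by (rule bij_betw_rectangular_band[OF f])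
  have "(\<Sum>b\<in>B. Re (marginal h A w b b)) = (\<Sum>a\<in>A. \<Sum>b\<in>B. (norm (w (h (a, b))))\<^sup>2)"
    by (subst sum.swap) (simp add: marginal_diag)
  also have "\<dots> = (\<Sum>p\<in>UNIV. (norm (w p))\<^sup>2)"
    by (simp add: sum.reindex_bij_betw[OF bij, symmetric] sum.cartesian_product case_prod_unfold)
  finally have trace: "(\<Sum>b\<in>B. Re (marginal h A w b b)) = (\<Sum>p\<in>UNIV. (norm (w p))\<^sup>2)" .
  have "cut_purity f w = (\<Sum>b\<in>B. \<Sum>b'\<in>B. marginal h A w b b' * marginal h A w b' b)"
    by (rule cut_purity_eq_marginal[OF bij]) (simp add: h_def rectangular_band_outer[OF f])
  moreover have "card B = card (range (\<lambda>q p. f p q))"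
    unfolding B_def by (rule card_range_rectangular_band[OF rectangular_band_flip[OF f]])
  ultimately show ?thesis
    using Re_trace_sq_ge[of B "marginal h A w", OF _ cnj_marginal[symmetric]] by (simp add: trace)
qed

lemma cut_purity_ge:
  fixes f :: "'p::finite \<Rightarrow> 'p \<Rightarrow> 'p"
  assumes "rectangular_band f"
  shows "(\<Sum>p\<in>UNIV. (norm (w p))\<^sup>2)\<^sup>2 / min (card (range f)) (card (range (\<lambda>q p. f p q)))
       \<le> Re (cut_purity f w)"
  using cut_purity_ge_card_right[OF assms, of w]
    cut_purity_ge_card_right[OF rectangular_band_flip[OF assms], of w]
  by (simp add: min_def cut_purity_flip[of f])

subsection \<open>Recombining tensor factors\<close>

definition prod_op :: "('x \<Rightarrow> 'x \<Rightarrow> 'x) \<Rightarrow> ('y \<Rightarrow> 'y \<Rightarrow> 'y) \<Rightarrow> 'x \<times> 'y \<Rightarrow> 'x \<times> 'y \<Rightarrow> 'x \<times> 'y" where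
  "prod_op f g p q = (f (fst p) (fst q), g (snd p) (snd q))"

lemma prod_op_simp [simp]: "prod_op f g (a, b) (a', b') = (f a a', g b b')"
  by (simp add: prod_op_def)

lemma prod_op_flip: "(\<lambda>p q. prod_op f g q p) = prod_op (\<lambda>x y. f y x) (\<lambda>x y. g y x)"
  by (simp add: prod_op_def fun_eq_iff)

lemma rectangular_band_prod_op:
  "rectangular_band f \<Longrightarrow> rectangular_band g \<Longrightarrow> rectangular_band (prod_op f g)"
  by (simp add: rectangular_band_def prod_op_def)

lemma card_range_prod_op:
  assumes "rectangular_band f" "rectangular_band g"
  shows "card (range (prod_op f g)) = card (range f) * card (range g)"
proof -
  have "card (range (prod_op f g)) = card (range (\<lambda>p. prod_op f g p e))" for e
    by (rule card_range_rectangular_band[OF rectangular_band_prod_op[OF assms], symmetric])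
  also have "range (\<lambda>p. prod_op f g p e) = range (\<lambda>x. f x (fst e)) \<times> range (\<lambda>y. g y (snd e))" for e
    by (auto simp: prod_op_def image_iff)
  finally show ?thesis
    by (simp add: card_cartesian_product card_range_rectangular_band assms)
qed

definition select :: "bool \<Rightarrow> 'x \<Rightarrow> 'x \<Rightarrow> 'x" where
  "select c x y = (if c then x else y)"

lemma select_simps [simp]: "select True x y = x" "select False x y = y"
  by (simp_all add: select_def)

lemma select_flip: "(\<lambda>x y. select c y x) = select (\<not> c)"
  by (simp add: select_def fun_eq_iff)

lemma rectangular_band_select: "rectangular_band (select c)"
  by (simp add: rectangular_band_def select_def)

lemma card_range_select: "card (range (select c :: 'x::finite \<Rightarrow> _)) = CARD('x) ^ of_bool c"
  using card_range_rectangular_band[OF rectangular_band_select, of c "undefined :: 'x"]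
  by (cases c) simp_all

definition recombine :: "nat set \<Rightarrow> 'a \<times> 'b \<times> 'c \<Rightarrow> 'a \<times> 'b \<times> 'c \<Rightarrow> 'a \<times> 'b \<times> 'c" where
  "recombine x = prod_op (select (1 \<in> x)) (prod_op (select (2 \<in> x)) (select (3 \<in> x)))"

lemma recombine_flip: "(\<lambda>p q. recombine x q p) = recombine ({1, 2, 3} - x)"
  by (simp add: recombine_def prod_op_flip select_flip)

lemma rectangular_band_recombine: "rectangular_band (recombine x)"
  unfolding recombine_def by (intro rectangular_band_prod_op rectangular_band_select)

lemma card_range_recombine:
  fixes d :: "nat \<Rightarrow> nat"
  assumes "d 1 = CARD('a::finite)" "d 2 = CARD('b::finite)" "d 3 = CARD('c::finite)"
    and "x \<subseteq> {1, 2, 3}"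
  shows "card (range (recombine x :: 'a \<times> 'b \<times> 'c \<Rightarrow> _)) = (\<Prod>i\<in>x. d i)"
proof -
  have "card (range (recombine x :: 'a \<times> 'b \<times> 'c \<Rightarrow> _)) = (\<Prod>i\<in>{1, 2, 3}. d i ^ of_bool (i \<in> x))"
    using assms(1-3) unfolding recombine_def
    by (simp add: card_range_prod_op rectangular_band_prod_op rectangular_band_select card_range_select)
  also have "\<dots> = (\<Prod>i\<in>x. d i ^ of_bool (i \<in> x))"
    using assms(4) by (intro prod.mono_neutral_right) auto
  finally show ?thesis
    by simp
qed

definition tangle :: "('p::finite \<Rightarrow> 'p \<Rightarrow> 'p) \<Rightarrow> complex^'p \<Rightarrow> real" where
  "tangle f \<psi> = 2 * (1 - Re (cut_purity f (($) \<psi>)))"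

lemma trace_sq_marginal:
  fixes h :: "'a::finite \<times> 'b::finite \<Rightarrow> 'p::finite"
  assumes "bij h" and "\<And>a b a' b'. f (h (a, b)) (h (a', b')) = h (a, b')"
  shows "trace_sq (marginal h UNIV w) = cut_purity f w"
  using cut_purity_eq_marginal[of h UNIV UNIV f w] assms by (simp add: trace_sq_def)

lemma tau_12_3_eq_tangle: "tau_12_3 = tangle (recombine {1, 2})"
proof
  fix \<psi> :: "complex^('a \<times> 'b \<times> 'c)"
  have "rho_3 \<psi> = marginal (\<lambda>((i, j), k). (i, j, k)) UNIV (($) \<psi>)"
    by (simp add: fun_eq_iff rho_3_def marginal_def sum.cartesian_product' flip: UNIV_Times_UNIV)
  moreover have "trace_sq (marginal (\<lambda>((i, j), k). (i, j, k)) UNIV (($) \<psi>))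
      = cut_purity (recombine {1, 2}) (($) \<psi>)"
    by (rule trace_sq_marginal[OF o_bij[where g = "\<lambda>(i, j, k). ((i, j), k)"]])
       (auto simp: recombine_def)
  ultimately show "tau_12_3 \<psi> = tangle (recombine {1, 2}) \<psi>"
    by (simp add: tau_12_3_def tangle_def)
qed

lemma tau_13_2_eq_tangle: "tau_13_2 = tangle (recombine {1, 3})"
proof
  fix \<psi> :: "complex^('a \<times> 'b \<times> 'c)"
  have "rho_2 \<psi> = marginal (\<lambda>((i, k), j). (i, j, k)) UNIV (($) \<psi>)"
    by (simp add: fun_eq_iff rho_2_def marginal_def sum.cartesian_product' flip: UNIV_Times_UNIV)
  moreover have "trace_sq (marginal (\<lambda>((i, k), j). (i, j, k)) UNIV (($) \<psi>))
      = cut_purity (recombine {1, 3}) (($) \<psi>)"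
    by (rule trace_sq_marginal[OF o_bij[where g = "\<lambda>(i, j, k). ((i, k), j)"]])
       (auto simp: recombine_def)
  ultimately show "tau_13_2 \<psi> = tangle (recombine {1, 3}) \<psi>"
    by (simp add: tau_13_2_def tangle_def)
qed

lemma tau_23_1_eq_tangle: "tau_23_1 = tangle (recombine {2, 3})"
proof
  fix \<psi> :: "complex^('a \<times> 'b \<times> 'c)"
  have "rho_1 \<psi> = marginal (\<lambda>((j, k), i). (i, j, k)) UNIV (($) \<psi>)"
    by (simp add: fun_eq_iff rho_1_def marginal_def sum.cartesian_product' flip: UNIV_Times_UNIV)
  moreover have "trace_sq (marginal (\<lambda>((j, k), i). (i, j, k)) UNIV (($) \<psi>))
      = cut_purity (recombine {2, 3}) (($) \<psi>)"
    by (rule trace_sq_marginal[OF o_bij[where g = "\<lambda>(i, j, k). ((j, k), i)"]])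
       (auto simp: recombine_def)
  ultimately show "tau_23_1 \<psi> = tangle (recombine {2, 3}) \<psi>"
    by (simp add: tau_23_1_def tangle_def)
qed

subsection \<open>Fourth moments of an invariant measure\<close>

lemma borel_measurable_moment [measurable]: "(\<lambda>\<psi>. moment i j k l (($) \<psi>)) \<in> borel_measurable borel"
  unfolding moment_def
  by (intro borel_measurable_continuous_onI continuous_intros)

lemma moment_right_commute: "moment i j k l w = moment i j l k w"
  by (simp add: moment_def mult_ac)

definition unitary_map :: "(complex^'n \<Rightarrow> complex^'n) \<Rightarrow> bool" where
  "unitary_map f \<longleftrightarrow> (\<exists>V. unitary_cmat V \<and> f = (*v) V)"

lemma unitary_mapI:
  fixes f g :: "complex^'n \<Rightarrow> complex^'n"
  assumes f: "Vector_Spaces.linear (*s) (*s) f" and g: "Vector_Spaces.linear (*s) (*s) g"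
    and inverse: "\<And>\<psi>. f (g \<psi>) = \<psi>" "\<And>\<psi>. g (f \<psi>) = \<psi>"
    and adjoint: "\<And>r s. g (axis s 1) $ r = cnj (f (axis r 1) $ s)"
  shows "unitary_map f"
proof -
  have "cadjoint (matrix f) = matrix g"
    by (simp add: cadjoint_def matrix_def vec_eq_iff adjoint)
  then have "unitary_cmat (matrix f)"
    by (simp add: unitary_cmat_def matrix_eq matrix_works f g inverse flip: matrix_vector_mul_assoc)
  moreover have "f = (*v) (matrix f)"
    by (simp add: fun_eq_iff matrix_works f)
  ultimately show ?thesis
    unfolding unitary_map_def by blast
qed

definition phase_shift :: "'n \<Rightarrow> complex \<Rightarrow> complex^'n \<Rightarrow> complex^'n" where
  "phase_shift p \<omega> \<psi> = (\<chi> r. (if r = p then \<omega> else 1) * \<psi> $ r)"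

lemma unitary_map_phase_shift:
  assumes "norm \<omega> = 1"
  shows "unitary_map (phase_shift p \<omega>)"
proof (rule unitary_mapI)
  have "\<omega> * cnj \<omega> = 1"
    using assms by (simp add: complex_norm_square[symmetric])
  then have "\<omega> * (cnj \<omega> * z) = z" "cnj \<omega> * (\<omega> * z) = z" for z
    by (simp_all add: mult.commute flip: mult.assoc)
  then show "phase_shift p \<omega> (phase_shift p (cnj \<omega>) \<psi>) = \<psi>"
    and "phase_shift p (cnj \<omega>) (phase_shift p \<omega> \<psi>) = \<psi>" for \<psi>
    by (simp_all add: phase_shift_def vec_eq_iff)
  show "Vector_Spaces.linear (*s) (*s) (phase_shift p z)" for z
    by unfold_locales (simp_all add: phase_shift_def vec_eq_iff algebra_simps)
  then show "Vector_Spaces.linear (*s) (*s) (phase_shift p (cnj \<omega>))" .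
  show "phase_shift p (cnj \<omega>) (axis s 1) $ r = cnj (phase_shift p \<omega> (axis r 1) $ s)" for r s
    by (auto simp: phase_shift_def axis_def)
qed

definition reflection :: "'n \<Rightarrow> 'n \<Rightarrow> real \<Rightarrow> complex \<Rightarrow> complex^'n \<Rightarrow> complex^'n" where
  "reflection i j c s \<psi> = (\<chi> r.
     if r = i then of_real c * \<psi> $ i + s * \<psi> $ j
     else if r = j then cnj s * \<psi> $ i - of_real c * \<psi> $ j
     else \<psi> $ r)"

lemma unitary_map_reflection:
  assumes "i \<noteq> j" "c\<^sup>2 + (norm s)\<^sup>2 = 1"
  shows "unitary_map (reflection i j c s)"
proof (rule unitary_mapI)
  have "of_real c * of_real c + s * cnj s = 1"
    using assms(2)
    by (simp add: complex_norm_square[symmetric] flip: power2_eq_square of_real_power of_real_add)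
  then have unit: "s * (cnj s * z) + of_real c * (of_real c * z) = z" for z
    by (metis add.commute distrib_right mult.assoc mult_1)
  show "reflection i j c s (reflection i j c s \<psi>) = \<psi>" for \<psi>
    using assms(1) by (simp add: reflection_def vec_eq_iff algebra_simps unit)
  then show "reflection i j c s (reflection i j c s \<psi>) = \<psi>" for \<psi> .
  show "Vector_Spaces.linear (*s) (*s) (reflection i j c s)"
    by unfold_locales (simp_all add: reflection_def vec_eq_iff algebra_simps)
  then show "Vector_Spaces.linear (*s) (*s) (reflection i j c s)" .
  show "reflection i j c s (axis q 1) $ r = cnj (reflection i j c s (axis r 1) $ q)" for q r
    using assms(1) by (auto simp: reflection_def axis_def)
qed

text \<open>Averaging over the fourth roots of unity cancels every mixed term of \<open>norm (w i + \<omega> * w j) ^ 4\<close>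
  except those in \<open>(norm (w i))\<^sup>2 * (norm (w j))\<^sup>2\<close>.\<close>

lemma sum_moment_roots_of_unity:
  "(\<Sum>\<omega>\<in>{1, - 1, \<i>, - \<i>}. moment i i i i (\<lambda>r. w r + \<omega> * w j)) / 4
     = moment i i i i w + moment j j j j w + 4 * moment i j i j w"
proof -
  have "(\<Sum>\<omega>\<in>{1, - 1, \<i>, - \<i>}. g \<omega>) = g 1 + g (- 1) + g \<i> + g (- \<i>)" for g :: "complex \<Rightarrow> complex"
    by (simp add: complex_eq_iff)
  then show ?thesis
    by (simp add: moment_def algebra_simps)
qed

context
  fixes \<mu> :: "(complex^'n) measure"
  assumes \<mu>: "unitarily_invariant_pure_state_measure \<mu>"
begin

lemma prob_space_invariant: "prob_space \<mu>"
  and sets_invariant [measurable_cong]: "sets \<mu> = sets borel"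
  and AE_norm_invariant: "AE \<psi> in \<mu>. norm \<psi> = 1"
  and distr_invariant: "unitary_map f \<Longrightarrow> distr \<mu> borel f = \<mu>"
  using \<mu> by (auto simp: unitarily_invariant_pure_state_measure_def unitary_map_def)

lemma integrable_moment: "integrable \<mu> (\<lambda>\<psi>. moment i j k l (($) \<psi>))"
proof -
  interpret prob_space \<mu> by (rule prob_space_invariant)
  show ?thesis
  proof (rule integrable_const_bound[where B = 1])
    show "AE \<psi> in \<mu>. norm (moment i j k l (($) \<psi>)) \<le> 1"
      using AE_norm_invariant
    proof eventually_elim
      case (elim \<psi>)
      have coord: "norm (\<psi> $ r) \<le> 1" for r
        using Finite_Cartesian_Product.norm_nth_le[of \<psi> r] elim by simp
      have "norm (\<psi> $ i) * norm (\<psi> $ j) * norm (\<psi> $ k) * norm (\<psi> $ l) \<le> 1 * 1 * 1 * 1"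
        by (intro mult_mono coord) auto
      then show ?case
        by (simp add: moment_def norm_mult)
    qed
  qed measurable
qed

definition mean_moment :: "'n \<Rightarrow> 'n \<Rightarrow> 'n \<Rightarrow> 'n \<Rightarrow> complex" where
  "mean_moment i j k l = (\<integral>\<psi>. moment i j k l (($) \<psi>) \<partial>\<mu>)"

lemma mean_moment_right_commute: "mean_moment i j k l = mean_moment i j l k"
  unfolding mean_moment_def by (subst moment_right_commute) (rule refl)

lemma
  assumes "unitary_map f"
  shows integrable_moment_unitary_map: "integrable \<mu> (\<lambda>\<psi>. moment i j k l (($) (f \<psi>)))"
    and integral_moment_unitary_map: "(\<integral>\<psi>. moment i j k l (($) (f \<psi>)) \<partial>\<mu>) = mean_moment i j k l"
proof -
  obtain V where f: "f = (*v) V"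
    using assms by (auto simp: unitary_map_def)
  have "f \<in> borel_measurable borel"
    unfolding f by (intro borel_measurable_continuous_onI linear_continuous_on)
       (simp add: matrix_vector_mul_bounded_linear)
  then have f_measurable [measurable]: "f \<in> measurable \<mu> borel"
    by measurable
  show "integrable \<mu> (\<lambda>\<psi>. moment i j k l (($) (f \<psi>)))"
    by (rule integrable_distr[OF f_measurable]) (simp add: distr_invariant[OF assms] integrable_moment)
  have "(\<integral>\<psi>. moment i j k l (($) \<psi>) \<partial>distr \<mu> borel f) = (\<integral>\<psi>. moment i j k l (($) (f \<psi>)) \<partial>\<mu>)"
    by (rule integral_distr) measurable
  then show "(\<integral>\<psi>. moment i j k l (($) (f \<psi>)) \<partial>\<mu>) = mean_moment i j k l"
    by (simp add: distr_invariant[OF assms] mean_moment_def)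
qed

text \<open>Multiplying the single coordinate \<open>p\<close> by \<open>\<i>\<close> multiplies the moment by a power of
  \<open>\<i>\<close> which is different from 1 for a suitable \<open>p\<close>, unless \<open>{i, j} = {k, l}\<close> as multisets.\<close>

lemma mean_moment_eq_0:
  assumes "\<not> (k = i \<and> l = j)" "\<not> (k = j \<and> l = i)"
  shows "mean_moment i j k l = 0"
proof -
  define c :: "'n \<Rightarrow> 'n \<Rightarrow> complex" where "c p r = (if r = p then \<i> else 1)" for p r
  have "moment i j k l (c p) * mean_moment i j k l = mean_moment i j k l" for p
  proof -
    have "moment i j k l (c p) * moment i j k l (($) \<psi>)
        = moment i j k l (($) (phase_shift p \<i> \<psi>))" for \<psi>
      by (simp add: moment_def phase_shift_def c_def)
    then have "moment i j k l (c p) * mean_moment i j k l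
        = (\<integral>\<psi>. moment i j k l (($) (phase_shift p \<i> \<psi>)) \<partial>\<mu>)"
      by (simp add: mean_moment_def flip: integral_mult_right_zero)
    also have "\<dots> = mean_moment i j k l"
      by (intro integral_moment_unitary_map unitary_map_phase_shift) simp
    finally show ?thesis .
  qed
  moreover have "\<exists>p. moment i j k l (c p) \<noteq> 1"
  proof (rule ccontr)
    assume "\<not> ?thesis"
    then have "moment i j k l (c p) = 1" for p
      by blast
    from this[of i] this[of j] this[of l] this[of k] show False
      using assms by (auto simp: c_def moment_def complex_eq_iff split: if_splits)
  qed
  ultimately show ?thesis
    by (metis mult_cancel_right1)
qed

lemma mean_moment_diag_eq: "mean_moment i i i i = mean_moment j j j j"
proof (cases "i = j")
  case False
  then have "mean_moment i i i i = (\<integral>\<psi>. moment i i i i (($) (reflection i j 0 1 \<psi>)) \<partial>\<mu>)"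
    by (intro integral_moment_unitary_map[symmetric] unitary_map_reflection) simp_all
  then show ?thesis
    by (simp add: reflection_def moment_def mean_moment_def)
qed simp

lemma mean_moment_diag_eq_double:
  assumes "i \<noteq> j"
  shows "mean_moment i i i i = 2 * mean_moment i j i j"
proof -
  define R where "R \<omega> = reflection i j (1 / sqrt 2) (\<omega> / sqrt 2)" for \<omega> :: complex
  have unitary: "unitary_map (R \<omega>)" if "\<omega> \<in> {1, - 1, \<i>, - \<i>}" for \<omega>
    unfolding R_def using that assms
    by (intro unitary_map_reflection) (auto simp: norm_divide power_divide)
  have R_moment: "moment i i i i (($) (R \<omega> \<psi>)) = moment i i i i (\<lambda>r. \<psi> $ r + \<omega> * \<psi> $ j) / 4" for \<omega> \<psi>
  proof -
    have "R \<omega> \<psi> $ i = (\<psi> $ i + \<omega> * \<psi> $ j) / sqrt 2"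
      by (simp add: R_def reflection_def add_divide_distrib)
    then show ?thesis
      by (simp add: moment_def flip: of_real_mult)
  qed
  have "4 * mean_moment i i i i = (\<Sum>\<omega>\<in>{1, - 1, \<i>, - \<i>}. \<integral>\<psi>. moment i i i i (($) (R \<omega> \<psi>)) \<partial>\<mu>)"
    by (simp add: integral_moment_unitary_map unitary complex_eq_iff)
  also have "\<dots> = (\<integral>\<psi>. (\<Sum>\<omega>\<in>{1, - 1, \<i>, - \<i>}. moment i i i i (($) (R \<omega> \<psi>))) \<partial>\<mu>)"
    by (intro Bochner_Integration.integral_sum[symmetric] integrable_moment_unitary_map unitary)
  also have "\<dots>
      = (\<integral>\<psi>. moment i i i i (($) \<psi>) + moment j j j j (($) \<psi>) + 4 * moment i j i j (($) \<psi>) \<partial>\<mu>)"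
    by (simp only: R_moment sum_divide_distrib[symmetric] sum_moment_roots_of_unity)
  also have "\<dots> = mean_moment i i i i + mean_moment j j j j + 4 * mean_moment i j i j"
    by (simp add: integrable_moment mean_moment_def)
  finally show ?thesis
    by (simp add: mean_moment_diag_eq[of j i])
qed

lemma sum_mean_moment: "(\<Sum>i\<in>UNIV. \<Sum>j\<in>UNIV. mean_moment i j i j) = 1"
proof -
  interpret prob_space \<mu> by (rule prob_space_invariant)
  have "(\<Sum>i\<in>UNIV. \<Sum>j\<in>UNIV. mean_moment i j i j)
      = (\<integral>\<psi>. (\<Sum>i\<in>UNIV. \<Sum>j\<in>UNIV. moment i j i j (($) \<psi>)) \<partial>\<mu>)"
    by (simp add: mean_moment_def integrable_moment)
  also have "\<dots> = (\<integral>\<psi>. 1 \<partial>\<mu>)"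
  proof (rule integral_cong_AE)
    show "AE \<psi> in \<mu>. (\<Sum>i\<in>UNIV. \<Sum>j\<in>UNIV. moment i j i j (($) \<psi>)) = 1"
      using AE_norm_invariant
    proof eventually_elim
      case (elim \<psi>)
      have "(\<Sum>i\<in>UNIV. \<psi> $ i * cnj (\<psi> $ i)) = of_real (\<Sum>i\<in>UNIV. (norm (\<psi> $ i))\<^sup>2)"
        by (simp only: of_real_sum complex_norm_square)
      also have "(\<Sum>i\<in>UNIV. (norm (\<psi> $ i))\<^sup>2) = (norm \<psi>)\<^sup>2"
        by (simp add: norm_vec_def L2_set_def sum_nonneg)
      finally have "(\<Sum>i\<in>UNIV. \<psi> $ i * cnj (\<psi> $ i)) = 1"
        using elim by simp
      moreover have "(\<Sum>i\<in>UNIV. \<Sum>j\<in>UNIV. moment i j i j (($) \<psi>))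
          = (\<Sum>i\<in>UNIV. \<psi> $ i * cnj (\<psi> $ i)) * (\<Sum>i\<in>UNIV. \<psi> $ i * cnj (\<psi> $ i))"
        by (simp add: sum_product moment_def mult_ac)
      ultimately show ?case by simp
    qed
  qed measurable
  finally show ?thesis by (simp add: prob_space)
qed

lemma mean_moment_pair:
  "mean_moment i j i j = (1 + of_bool (i = j)) / of_nat (CARD('n) * (CARD('n) + 1))"
proof -
  define b where "b = mean_moment i i i i / 2"
  have mean: "mean_moment p q p q = b + (if p = q then b else 0)" for p q
    using mean_moment_diag_eq[of p i] mean_moment_diag_eq_double[of p q]
    by (cases "p = q") (simp_all add: b_def field_simps)
  have "1 = (\<Sum>p\<in>UNIV. \<Sum>q\<in>UNIV. b + (if p = (q :: 'n) then b else 0))"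
    using sum_mean_moment by (simp add: mean)
  also have "\<dots> = b * of_nat (CARD('n) * (CARD('n) + 1))"
    by (simp add: sum.distrib algebra_simps)
  finally have "b = 1 / of_nat (CARD('n) * (CARD('n) + 1))"
    by (metis mult_zero_right nonzero_eq_divide_eq zero_neq_one)
  then show ?thesis
    by (simp add: mean)
qed

lemma mean_moment_eq:
  "mean_moment i j k l
     = (\<Sum>c\<in>UNIV. of_bool (k = select c i j \<and> l = select c j i)) / of_nat (CARD('n) * (CARD('n) + 1))"
proof -
  consider (straight) "k = i" "l = j" | (crossed) "k = j" "l = i"
    | (unpaired) "\<not> (k = i \<and> l = j)" "\<not> (k = j \<and> l = i)"
    by blast
  then show ?thesis
  proof cases
    case straight
    then show ?thesis by (auto simp: UNIV_bool mean_moment_pair)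
  next
    case crossed
    then show ?thesis
      by (auto simp: UNIV_bool mean_moment_pair mean_moment_right_commute[of i j j i])
  next
    case unpaired
    then show ?thesis by (simp add: UNIV_bool mean_moment_eq_0)
  qed
qed

end

subsection \<open>Averages over states with pairing moments\<close>

text \<open>The intended \<open>\<phi> x i j\<close> agrees with \<open>i\<close> on the tensor factors selected by \<open>x\<close> and with \<open>j\<close> on the
  others.\<close>

definition has_pairing_moments ::
  "'s measure \<Rightarrow> ('s \<Rightarrow> complex^'n) \<Rightarrow> 'x set \<Rightarrow> ('x \<Rightarrow> 'n \<Rightarrow> 'n \<Rightarrow> 'n) \<Rightarrow> nat \<Rightarrow> bool" where
  "has_pairing_moments M \<Psi> S \<phi> N \<longleftrightarrow>
     (\<forall>i j k l. has_bochner_integral M (\<lambda>\<omega>. moment i j k l (($) (\<Psi> \<omega>)))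
        ((\<Sum>x\<in>S. of_bool (k = \<phi> x i j \<and> l = \<phi> x j i)) / of_nat N))"

lemma has_pairing_moments_invariant:
  fixes \<mu> :: "(complex^'n) measure"
  assumes "unitarily_invariant_pure_state_measure \<mu>"
  shows "has_pairing_moments \<mu> (\<lambda>\<psi>. \<psi>) UNIV select (CARD('n) * (CARD('n) + 1))"
  unfolding has_pairing_moments_def has_bochner_integral_iff mean_moment_eq[OF assms, symmetric]
  by (intro allI conjI integrable_moment assms) (simp add: mean_moment_def[OF assms])

lemma has_pairing_moments_reindex:
  assumes "bij_betw h T S" "has_pairing_moments M \<Psi> S \<phi> N"
  shows "has_pairing_moments M \<Psi> T (\<lambda>x. \<phi> (h x)) N"
  using assms(2) by (simp add: has_pairing_moments_def sum.reindex_bij_betw[OF assms(1), symmetric])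

lemma (in pair_sigma_finite) has_bochner_integral_tensor:
  fixes f :: "'a \<Rightarrow> complex" and g :: "'b \<Rightarrow> complex"
  assumes f: "has_bochner_integral M1 f x" and g: "has_bochner_integral M2 g y"
  shows "has_bochner_integral (M1 \<Otimes>\<^sub>M M2) (\<lambda>p. f (fst p) * g (snd p)) (x * y)"
proof -
  have integrable: "integrable M1 f" "integrable M2 g"
    and integral: "(\<integral>x. f x \<partial>M1) = x" "(\<integral>y. g y \<partial>M2) = y"
    using f g by (simp_all add: has_bochner_integral_iff)
  from integrable have [measurable]: "f \<in> borel_measurable M1" "g \<in> borel_measurable M2"
    by auto
  have product: "integrable (M1 \<Otimes>\<^sub>M M2) (\<lambda>p. f (fst p) * g (snd p))"
    using integrable by (intro Fubini_integrable) (auto simp: norm_mult)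
  then show ?thesis
    using integral_fst'[OF product] by (simp add: has_bochner_integral_iff integral)
qed

definition tensor :: "complex^'m \<Rightarrow> complex^'n \<Rightarrow> complex^('m \<times> 'n)" where
  "tensor \<psi> \<phi> = vec_lambda (\<lambda>(i, j). \<psi> $ i * \<phi> $ j)"

lemma tensor3_eq_tensor: "tensor3 \<psi>1 \<psi>2 \<psi>3 = tensor \<psi>1 (tensor \<psi>2 \<psi>3)"
  by (simp add: tensor3_def tensor_def vec_eq_iff mult.assoc)

lemma moment_tensor:
  "moment i j k l (($) (tensor \<psi> \<phi>))
     = moment (fst i) (fst j) (fst k) (fst l) (($) \<psi>) * moment (snd i) (snd j) (snd k) (snd l) (($) \<phi>)"
  by (simp add: moment_def tensor_def case_prod_unfold mult_ac)

lemma (in pair_sigma_finite) has_pairing_moments_tensor: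
  assumes "has_pairing_moments M1 \<Psi>1 S \<phi>1 K" "has_pairing_moments M2 \<Psi>2 T \<phi>2 L"
  shows "has_pairing_moments (M1 \<Otimes>\<^sub>M M2) (\<lambda>p. tensor (\<Psi>1 (fst p)) (\<Psi>2 (snd p)))
           (S \<times> T) (\<lambda>(x, y). prod_op (\<phi>1 x) (\<phi>2 y)) (K * L)"
proof -
  have "has_bochner_integral (M1 \<Otimes>\<^sub>M M2) (\<lambda>p. moment i j k l (($) (tensor (\<Psi>1 (fst p)) (\<Psi>2 (snd p)))))
          (((\<Sum>x\<in>S. of_bool (fst k = \<phi>1 x (fst i) (fst j) \<and> fst l = \<phi>1 x (fst j) (fst i))) / of_nat K)
         * ((\<Sum>y\<in>T. of_bool (snd k = \<phi>2 y (snd i) (snd j) \<and> snd l = \<phi>2 y (snd j) (snd i))) / of_nat L))"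
    for i j k l
    using assms unfolding has_pairing_moments_def moment_tensor
    by (intro has_bochner_integral_tensor) blast+
  then show ?thesis
    by (simp add: has_pairing_moments_def sum_product sum.cartesian_product case_prod_unfold
        prod_op_def prod_eq_iff of_bool_conj mult_ac)
qed

text \<open>The operator \<open>U\<close> as an unnormalised vector on two copies of the space. The second index carries
  the primed labels.\<close>

definition choi_vec :: "complex^'n^'m \<Rightarrow> 'm \<times> 'n \<Rightarrow> complex" where
  "choi_vec U = (\<lambda>(p, i). U $ p $ i)"

lemma moment_matrix_vector:
  fixes U :: "complex^'n^'m"
  shows "moment p q r s (($) (U *v \<psi>)) = (\<Sum>i\<in>UNIV. \<Sum>j\<in>UNIV. \<Sum>k\<in>UNIV. \<Sum>l\<in>UNIV.
     moment (p, i) (q, j) (r, k) (s, l) (choi_vec U) * moment i j k l (($) \<psi>))"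
proof -
  have sum_product4: "(\<Sum>i\<in>UNIV. a i) * (\<Sum>j\<in>UNIV. b j) * (\<Sum>k\<in>UNIV. c k) * (\<Sum>l\<in>UNIV. d l)
     = (\<Sum>i\<in>UNIV. \<Sum>j\<in>UNIV. \<Sum>k\<in>UNIV. \<Sum>l\<in>UNIV. a i * b j * c k * d l)"
    for a b c d :: "'n \<Rightarrow> complex"
    by (simp only: sum_distrib_left[symmetric] sum_distrib_right[symmetric])
  show ?thesis
    unfolding moment_def matrix_vector_mult_def vec_lambda_beta cnj_sum sum_product4
    by (intro sum.cong refl) (simp add: choi_vec_def mult_ac)
qed

lemma sum_mult_sum_of_bool:
  fixes g :: "'n::finite \<Rightarrow> 'n \<Rightarrow> complex"
  shows "(\<Sum>k\<in>UNIV. \<Sum>l\<in>UNIV. g k l * (\<Sum>x\<in>S. of_bool (k = \<alpha> x \<and> l = \<beta> x))) = (\<Sum>x\<in>S. g (\<alpha> x) (\<beta> x))"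
proof -
  have "(\<Sum>k\<in>UNIV. \<Sum>l\<in>UNIV. g k l * (\<Sum>x\<in>S. of_bool (k = \<alpha> x \<and> l = \<beta> x)))
      = (\<Sum>x\<in>S. \<Sum>k\<in>UNIV. \<Sum>l\<in>UNIV. g k l * of_bool (k = \<alpha> x \<and> l = \<beta> x))"
    unfolding sum_distrib_left by (simp only: sum.swap[of _ S])
  also have "\<dots> = (\<Sum>x\<in>S. g (\<alpha> x) (\<beta> x))"
    unfolding of_bool_conj
    by (simp add: of_bool_def if_distrib[of "\<lambda>x. _ * x"] if_distrib[of "\<lambda>x. x * _"] cong: if_cong)
  finally show ?thesis .
qed

lemma has_bochner_integral_moment_matrix_vector:
  fixes U :: "complex^'n^'m"
  assumes "has_pairing_moments M \<Psi> S \<phi> N"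
  shows "has_bochner_integral M (\<lambda>\<omega>. moment p q r s (($) (U *v \<Psi> \<omega>)))
    ((\<Sum>x\<in>S. \<Sum>i\<in>UNIV. \<Sum>j\<in>UNIV.
        moment (p, i) (q, j) (r, \<phi> x i j) (s, \<phi> x j i) (choi_vec U)) / of_nat N)"
proof -
  define u where "u i j k l = moment (p, i) (q, j) (r, k) (s, l) (choi_vec U)" for i j k l
  have "has_bochner_integral M
      (\<lambda>\<omega>. \<Sum>i\<in>UNIV. \<Sum>j\<in>UNIV. \<Sum>k\<in>UNIV. \<Sum>l\<in>UNIV. u i j k l * moment i j k l (($) (\<Psi> \<omega>)))
      (\<Sum>i\<in>UNIV. \<Sum>j\<in>UNIV. \<Sum>k\<in>UNIV. \<Sum>l\<in>UNIV.
         u i j k l * ((\<Sum>x\<in>S. of_bool (k = \<phi> x i j \<and> l = \<phi> x j i)) / of_nat N))"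
    using assms unfolding has_pairing_moments_def
    by (intro has_bochner_integral_sum has_bochner_integral_mult_right) blast
  also have "(\<Sum>i\<in>UNIV. \<Sum>j\<in>UNIV. \<Sum>k\<in>UNIV. \<Sum>l\<in>UNIV.
         u i j k l * ((\<Sum>x\<in>S. of_bool (k = \<phi> x i j \<and> l = \<phi> x j i)) / of_nat N))
      = (\<Sum>i\<in>UNIV. \<Sum>j\<in>UNIV. \<Sum>x\<in>S. u i j (\<phi> x i j) (\<phi> x j i)) / of_nat N"
    by (simp only: times_divide_eq_right sum_divide_distrib[symmetric] sum_mult_sum_of_bool)
  also have "\<dots> = (\<Sum>x\<in>S. \<Sum>i\<in>UNIV. \<Sum>j\<in>UNIV. u i j (\<phi> x i j) (\<phi> x j i)) / of_nat N"
    by (simp only: sum.swap[of _ S])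
  finally show ?thesis
    unfolding moment_matrix_vector u_def .
qed

lemma cut_purity_prod_op:
  "cut_purity (prod_op f g) w = (\<Sum>p\<in>UNIV. \<Sum>q\<in>UNIV. \<Sum>i\<in>UNIV. \<Sum>j\<in>UNIV.
     moment (p, i) (q, j) (f p q, g i j) (f q p, g j i) w)"
proof -
  have "cut_purity (prod_op f g) w = (\<Sum>p\<in>UNIV. \<Sum>i\<in>UNIV. \<Sum>q\<in>UNIV. \<Sum>j\<in>UNIV.
     moment (p, i) (q, j) (f p q, g i j) (f q p, g j i) w)"
    by (simp add: cut_purity_def sum.cartesian_product' flip: UNIV_Times_UNIV)
  also have "\<dots> = (\<Sum>p\<in>UNIV. \<Sum>q\<in>UNIV. \<Sum>i\<in>UNIV. \<Sum>j\<in>UNIV.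
     moment (p, i) (q, j) (f p q, g i j) (f q p, g j i) w)"
    by (intro sum.cong refl sum.swap)
  finally show ?thesis .
qed

lemma has_bochner_integral_cut_purity:
  fixes U :: "complex^'n^'m"
  assumes "has_pairing_moments M \<Psi> S \<phi> N"
  shows "has_bochner_integral M (\<lambda>\<omega>. cut_purity f (($) (U *v \<Psi> \<omega>)))
    ((\<Sum>x\<in>S. cut_purity (prod_op f (\<phi> x)) (choi_vec U)) / of_nat N)"
proof -
  define u where "u p q x i j = moment (p, i) (q, j) (f p q, \<phi> x i j) (f q p, \<phi> x j i) (choi_vec U)"
    for p q x i j
  have "has_bochner_integral M (\<lambda>\<omega>. cut_purity f (($) (U *v \<Psi> \<omega>)))
      (\<Sum>p\<in>UNIV. \<Sum>q\<in>UNIV. (\<Sum>x\<in>S. \<Sum>i\<in>UNIV. \<Sum>j\<in>UNIV. u p q x i j) / of_nat N)"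
    unfolding cut_purity_def u_def
    by (intro has_bochner_integral_sum has_bochner_integral_moment_matrix_vector assms)
  also have "(\<Sum>p\<in>UNIV. \<Sum>q\<in>UNIV. (\<Sum>x\<in>S. \<Sum>i\<in>UNIV. \<Sum>j\<in>UNIV. u p q x i j) / of_nat N)
      = (\<Sum>x\<in>S. \<Sum>p\<in>UNIV. \<Sum>q\<in>UNIV. \<Sum>i\<in>UNIV. \<Sum>j\<in>UNIV. u p q x i j) / of_nat N"
    by (simp only: sum_divide_distrib[symmetric] sum.swap[of _ S])
  finally show ?thesis
    by (simp add: cut_purity_prod_op u_def)
qed

lemma unitary_sum_norm_choi_vec:
  fixes U :: "complex^'n^'n"
  assumes "unitary_cmat U"
  shows "(\<Sum>p\<in>UNIV. (norm (choi_vec U p))\<^sup>2) = CARD('n)"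
proof -
  have "(\<Sum>s\<in>UNIV. (norm (U $ r $ s))\<^sup>2) = 1" for r
  proof -
    have "complex_of_real (\<Sum>s\<in>UNIV. (norm (U $ r $ s))\<^sup>2) = (U ** cadjoint U) $ r $ r"
      by (simp only: matrix_matrix_mult_def cadjoint_def vec_lambda_beta of_real_sum complex_norm_square)
    also have "\<dots> = 1"
      using assms by (simp add: unitary_cmat_def mat_def)
    finally show ?thesis
      using of_real_eq_1_iff by blast
  qed
  then show ?thesis
    by (simp add: choi_vec_def sum.cartesian_product' flip: UNIV_Times_UNIV)
qed

lemma has_bochner_integral_tangle:
  fixes U :: "complex^'n^'m"
  assumes "prob_space M" "has_pairing_moments M \<Psi> S \<phi> N"
  shows "has_bochner_integral M (\<lambda>\<omega>. tangle f (U *v \<Psi> \<omega>))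
    (2 - 2 * ((\<Sum>x\<in>S. Re (cut_purity (prod_op f (\<phi> x)) (choi_vec U))) / N))"
proof -
  interpret prob_space M by fact
  have "has_bochner_integral M (\<lambda>\<omega>. tangle f (U *v \<Psi> \<omega>))
     (2 * (1 - Re ((\<Sum>x\<in>S. cut_purity (prod_op f (\<phi> x)) (choi_vec U)) / of_nat N)))"
    unfolding tangle_def
    by (intro has_bochner_integral_mult_right has_bochner_integral_diff has_bochner_integral_Re
        has_bochner_integral_cut_purity assms) (simp_all add: has_bochner_integral_iff prob_space)
  then show ?thesis
    by (simp add: Re_divide_of_nat)
qed

lemma integral_tangle_le:
  fixes U :: "complex^'n^'n"
  assumes M: "prob_space M" "has_pairing_moments M \<Psi> S \<phi> N"
    and U: "unitary_cmat U"
    and f: "rectangular_band f" and \<phi>: "\<And>x. x \<in> S \<Longrightarrow> rectangular_band (\<phi> x)"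
  shows "(\<integral>\<omega>. tangle f (U *v \<Psi> \<omega>) \<partial>M)
    \<le> 2 - 2 * ((\<Sum>x\<in>S. (real CARD('n))\<^sup>2 / min (card (range f) * card (range (\<phi> x)))
          (card (range (\<lambda>q p. f p q)) * card (range (\<lambda>j i. \<phi> x i j)))) / N)"
proof -
  have "(real CARD('n))\<^sup>2 / min (card (range f) * card (range (\<phi> x)))
          (card (range (\<lambda>q p. f p q)) * card (range (\<lambda>j i. \<phi> x i j)))
      \<le> Re (cut_purity (prod_op f (\<phi> x)) (choi_vec U))" if "x \<in> S" for x
    using cut_purity_ge[OF rectangular_band_prod_op[OF f \<phi>[OF that]], of "choi_vec U"]
    unfolding prod_op_flip
    by (simp add: unitary_sum_norm_choi_vec[OF U] card_range_prod_op rectangular_band_flip f \<phi> that)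
  then show ?thesis
    unfolding has_bochner_integral_integral_eq[OF has_bochner_integral_tangle[OF M]]
    by (intro diff_left_mono mult_left_mono divide_right_mono sum_mono) simp_all
qed

subsection \<open>Three tensor factors\<close>

lemma eps_tilde_eq:
  assumes "\<forall>i\<in>{1, 2, 3}. 0 < d i" "0 < dab" "0 < dc"
  shows "eps_tilde dab dc d = 2 - 2 * ((\<Sum>x\<in>Pow {1, 2, 3}. (real (\<Prod>i\<in>{1, 2, 3}. d i))\<^sup>2 /
           min (dab * (\<Prod>i\<in>x. d i)) (dc * (\<Prod>i\<in>{1, 2, 3} - x. d i))) / (\<Prod>i\<in>{1, 2, 3}. d i * (d i + 1)))"
proof -
  define m where "m x = min (dab * (\<Prod>i\<in>x. d i)) (dc * (\<Prod>i\<in>{1, 2, 3} - x. d i))" for x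
  have m_pos: "0 < m x" if "x \<in> Pow {1, 2, 3}" for x
    using assms that by (auto simp: m_def intro!: prod_pos)
  have "(\<Sum>x\<in>Pow {1, 2, 3}. (real (m x) - 1) / real (m x)) = (\<Sum>x\<in>Pow {1, 2, 3}. 1 - 1 / real (m x))"
    using m_pos by (intro sum.cong refl) (simp add: diff_divide_distrib)
  also have "\<dots> = 8 - (\<Sum>x\<in>Pow {1, 2, 3}. 1 / real (m x))"
    by (simp add: sum_subtractf card_Pow)
  finally have "eps_tilde dab dc d = 2 - 2 * (\<Prod>i\<in>{1, 2, 3}. real (d i) / (real (d i) + 1)) *
       (\<Sum>x\<in>Pow {1, 2, 3}. 1 / real (m x))"
    unfolding eps_tilde_def Let_def m_def[symmetric] by simp
  also have "(\<Prod>i\<in>{1, 2, 3}. real (d i) / (real (d i) + 1))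
      = (real (\<Prod>i\<in>{1, 2, 3}. d i))\<^sup>2 / real (\<Prod>i\<in>{1, 2, 3}. d i * (d i + 1))"
  proof -
    have "real (d i) / (real (d i) + 1) = (real (d i))\<^sup>2 / real (d i * (d i + 1))"
      if "i \<in> {1, 2, 3}" for i
      using assms(1) that unfolding of_nat_mult power2_eq_square by simp
    then show ?thesis
      unfolding of_nat_prod prod_power_distrib prod_dividef[symmetric] by (intro prod.cong refl)
  qed
  also have "2 * (D / K) * (\<Sum>x\<in>Pow {1, 2, 3}. 1 / real (m x))
      = 2 * ((\<Sum>x\<in>Pow {1, 2, 3}. D / m x) / K)" for D K
    by (simp add: sum_distrib_left sum_divide_distrib mult.commute)
  finally show ?thesis
    unfolding m_def .
qed

context
  fixes \<mu>1 :: "(complex^'a) measure" and \<mu>2 :: "(complex^'b) measure"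
    and \<mu>3 :: "(complex^'c) measure" and d :: "nat \<Rightarrow> nat"
  assumes \<mu>: "unitarily_invariant_pure_state_measure \<mu>1"
    "unitarily_invariant_pure_state_measure \<mu>2"
    "unitarily_invariant_pure_state_measure \<mu>3"
    and d: "d 1 = CARD('a)" "d 2 = CARD('b)" "d 3 = CARD('c)"
begin

interpretation P1: prob_space \<mu>1 using \<mu>(1) by (rule prob_space_invariant)
interpretation P2: prob_space \<mu>2 using \<mu>(2) by (rule prob_space_invariant)
interpretation P3: prob_space \<mu>3 using \<mu>(3) by (rule prob_space_invariant)
interpretation P23: pair_prob_space \<mu>2 \<mu>3 ..
interpretation P: pair_prob_space \<mu>1 "\<mu>2 \<Otimes>\<^sub>M \<mu>3" ..

lemma has_pairing_moments_tensor3: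
  "has_pairing_moments (\<mu>1 \<Otimes>\<^sub>M (\<mu>2 \<Otimes>\<^sub>M \<mu>3)) (\<lambda>p. tensor3 (fst p) (fst (snd p)) (snd (snd p)))
     (Pow {1, 2, 3}) recombine (\<Prod>i\<in>{1, 2, 3}. d i * (d i + 1))"
proof -
  have bij: "bij_betw (\<lambda>x. (1 \<in> x, 2 \<in> x, 3 \<in> x)) (Pow {1, 2, 3 :: nat}) (UNIV \<times> UNIV \<times> UNIV)"
    by (rule bij_betw_byWitness[where f' = "\<lambda>(a, b, c). {i. i = 1 \<and> a \<or> i = 2 \<and> b \<or> i = 3 \<and> c}"]) auto
  have "has_pairing_moments (\<mu>2 \<Otimes>\<^sub>M \<mu>3) (\<lambda>p. tensor (fst p) (snd p)) (UNIV \<times> UNIV)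
     (\<lambda>(b, c). prod_op (select b) (select c)) (d 2 * (d 2 + 1) * (d 3 * (d 3 + 1)))"
    unfolding d by (intro P23.has_pairing_moments_tensor has_pairing_moments_invariant \<mu>)
  then have "has_pairing_moments (\<mu>1 \<Otimes>\<^sub>M (\<mu>2 \<Otimes>\<^sub>M \<mu>3))
     (\<lambda>p. tensor (fst p) (tensor (fst (snd p)) (snd (snd p))))
     (UNIV \<times> UNIV \<times> UNIV)
     (\<lambda>(a, y). prod_op (select a) (case y of (b, c) \<Rightarrow> prod_op (select b) (select c)))
     (d 1 * (d 1 + 1) * (d 2 * (d 2 + 1) * (d 3 * (d 3 + 1))))"
    unfolding d(1) by (intro P.has_pairing_moments_tensor has_pairing_moments_invariant \<mu>)
  from has_pairing_moments_reindex[OF bij this] show ?thesis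
    by (simp add: tensor3_eq_tensor recombine_def[abs_def] mult.assoc)
qed

lemma integrable_tangle:
  "integrable (\<mu>1 \<Otimes>\<^sub>M (\<mu>2 \<Otimes>\<^sub>M \<mu>3)) (\<lambda>p. tangle f (U *v tensor3 (fst p) (fst (snd p)) (snd (snd p))))"
  using has_bochner_integral_tangle[OF P.prob_space_axioms has_pairing_moments_tensor3]
  by (rule integrable.intros)

lemma avg_prod_tau1:
  "avg_prod tau1 U \<mu>1 \<mu>2 \<mu>3
     = (avg_prod tau_12_3 U \<mu>1 \<mu>2 \<mu>3 + avg_prod tau_13_2 U \<mu>1 \<mu>2 \<mu>3
        + avg_prod tau_23_1 U \<mu>1 \<mu>2 \<mu>3) / 3"
  unfolding avg_prod_def tau1_def tau_12_3_eq_tangle tau_13_2_eq_tangle tau_23_1_eq_tangle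
  by (simp only: integral_divide_zero Bochner_Integration.integral_add
        Bochner_Integration.integrable_add integrable_tangle)

lemma avg_prod_tangle_le:
  assumes "unitary_cmat U" and z: "z \<subseteq> {1, 2, 3}"
  shows "avg_prod (tangle (recombine z)) U \<mu>1 \<mu>2 \<mu>3
    \<le> eps_tilde (\<Prod>i\<in>z. d i) (\<Prod>i\<in>{1, 2, 3} - z. d i) d"
proof -
  have d_pos: "\<forall>i\<in>{1, 2, 3}. 0 < d i"
    using d by simp
  have dim_pos: "0 < (\<Prod>i\<in>z. d i)" "0 < (\<Prod>i\<in>{1, 2, 3} - z. d i)"
    using z d_pos by (auto intro!: prod_pos)
  have card_UNIV: "CARD('a \<times> 'b \<times> 'c) = (\<Prod>i\<in>{1, 2, 3}. d i)"
    using d by simp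
  have card_range: "card (range (recombine x :: 'a \<times> 'b \<times> 'c \<Rightarrow> _)) = (\<Prod>i\<in>x. d i)"
     "card (range (\<lambda>q p :: 'a \<times> 'b \<times> 'c. recombine x p q)) = (\<Prod>i\<in>{1, 2, 3} - x. d i)"
     if "x \<in> Pow {1, 2, 3}" for x
    using that unfolding recombine_flip by (intro card_range_recombine d; blast)+
  show ?thesis
    using integral_tangle_le[OF P.prob_space_axioms has_pairing_moments_tensor3 assms(1)
        rectangular_band_recombine rectangular_band_recombine, of z]
    unfolding avg_prod_def eps_tilde_eq[OF d_pos dim_pos]
    by (simp only: card_UNIV card_range PowI[OF z] cong: sum.cong)
qed

end

theorem theorem2:
  fixes U :: "complex^('a::finite \<times> 'b::finite \<times> 'c::finite)^('a \<times> 'b \<times> 'c)"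
    and \<mu>1 :: "(complex^'a) measure" and \<mu>2 :: "(complex^'b) measure"
    and \<mu>3 :: "(complex^'c) measure"
  defines "d \<equiv> (\<lambda>i::nat. if i = 1 then CARD('a) else if i = 2 then CARD('b) else CARD('c))"
  assumes "unitary_cmat U"
    and "unitarily_invariant_pure_state_measure \<mu>1"
    and "unitarily_invariant_pure_state_measure \<mu>2"
    and "unitarily_invariant_pure_state_measure \<mu>3"
  shows "avg_prod tau_12_3 U \<mu>1 \<mu>2 \<mu>3 \<le> eps_tilde (d 1 * d 2) (d 3) d
       \<and> avg_prod tau_13_2 U \<mu>1 \<mu>2 \<mu>3 \<le> eps_tilde (d 1 * d 3) (d 2) d
       \<and> avg_prod tau_23_1 U \<mu>1 \<mu>2 \<mu>3 \<le> eps_tilde (d 2 * d 3) (d 1) d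
       \<and> avg_prod tau1 U \<mu>1 \<mu>2 \<mu>3 \<le>
           (eps_tilde (d 1 * d 2) (d 3) d + eps_tilde (d 1 * d 3) (d 2) d
            + eps_tilde (d 2 * d 3) (d 1) d) / 3"
proof -
  have d: "d 1 = CARD('a)" "d 2 = CARD('b)" "d 3 = CARD('c)"
    by (simp_all add: d_def)
  note tangle_le = avg_prod_tangle_le[OF assms(3-5) d assms(2)]
  have bound_12_3: "avg_prod tau_12_3 U \<mu>1 \<mu>2 \<mu>3 \<le> eps_tilde (d 1 * d 2) (d 3) d"
    using tangle_le[of "{1, 2}"] by (simp add: tau_12_3_eq_tangle insert_Diff_if)
  have bound_13_2: "avg_prod tau_13_2 U \<mu>1 \<mu>2 \<mu>3 \<le> eps_tilde (d 1 * d 3) (d 2) d"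
    using tangle_le[of "{1, 3}"] by (simp add: tau_13_2_eq_tangle insert_Diff_if)
  have bound_23_1: "avg_prod tau_23_1 U \<mu>1 \<mu>2 \<mu>3 \<le> eps_tilde (d 2 * d 3) (d 1) d"
    using tangle_le[of "{2, 3}"] by (simp add: tau_23_1_eq_tangle insert_Diff_if)
  from bound_12_3 bound_13_2 bound_23_1 show ?thesis
    by (simp add: avg_prod_tau1[OF assms(3-5) d])
qed

end
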